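(* For positive integers $m,n$ and $0\le k\le\min\{m,n\}$, let $\tau_k(K_{m,n})$ denote the number of spanning trees of the complete bipartite graph $K_{m,n}$ containing all edges of a given matching of size $k$ (this number depends only on $k$). Then for any $1\le k\le \min\{m,n\}-1$, $$\frac{\tau_{k+1}(K_{m,n})}{\tau_k(K_{m,n})}=\frac{(m+n)(m+n-k-1)}{mn(m+n-k)}.$$ *)

theory Defs
  imports Complex_Main
begin

text \<open>
  A simple graph is given by a vertex set \<open>V\<close> and a set \<open>E\<close> of edges, each edge being the
  two-element set of its endpoints. The notion \<open>spanning_tree\<close> of the AFP entry Graph\_Theory does not
  fit here: its cycles are directed, so in a symmetric digraph every edge already yields a cycle
  \<open>a, b, a\<close>.
\<close>

definition connected_graph :: "'a set \<Rightarrow> 'a set set \<Rightarrow> bool" where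
  "connected_graph V E \<longleftrightarrow> V \<noteq> {} \<and> (\<forall>u\<in>V. \<forall>v\<in>V. (u, v) \<in> {(x, y). {x, y} \<in> E}\<^sup>*)"

text \<open>A cycle is the list of its vertices; the index shift modulo the length closes it up.\<close>

definition cycle_in :: "'a set set \<Rightarrow> 'a list \<Rightarrow> bool" where
  "cycle_in E c \<longleftrightarrow> length c \<ge> 3 \<and> distinct c \<and>
     (\<forall>i<length c. {c ! i, c ! (Suc i mod length c)} \<in> E)"

definition tree_graph :: "'a set \<Rightarrow> 'a set set \<Rightarrow> bool" where
  "tree_graph V E \<longleftrightarrow> connected_graph V E \<and> \<not> (\<exists>c. cycle_in E c)"

text \<open>A spanning subgraph of \<open>(V, E)\<close> has vertex set \<open>V\<close>, so it is identified with its edge set.\<close>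

definition spanning_tree_of :: "'a set \<Rightarrow> 'a set set \<Rightarrow> 'a set set \<Rightarrow> bool" where
  "spanning_tree_of V E T \<longleftrightarrow> T \<subseteq> E \<and> tree_graph V T"

definition matching_in :: "'a set set \<Rightarrow> 'a set set \<Rightarrow> bool" where
  "matching_in E M \<longleftrightarrow> M \<subseteq> E \<and> pairwise disjnt M"

definition K_verts :: "nat \<Rightarrow> nat \<Rightarrow> (nat + nat) set" where
  "K_verts m n = {..<m} <+> {..<n}"

definition K_edges :: "nat \<Rightarrow> nat \<Rightarrow> (nat + nat) set set" where
  "K_edges m n = {{Inl i, Inr j} | i j. i < m \<and> j < n}"

definition num_spanning_trees_containing :: "nat \<Rightarrow> nat \<Rightarrow> (nat + nat) set set \<Rightarrow> nat" where
  "num_spanning_trees_containing m n M =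
     card {T. spanning_tree_of (K_verts m n) (K_edges m n) T \<and> M \<subseteq> T}"

text \<open>
  The common number of spanning trees of $K_{m,n}$ containing a matching of size \<open>k\<close>; meaningful
  only if this number is the same for all such matchings (and \<open>k \<le> min m n\<close>, so that there is one).
\<close>

definition tau :: "nat \<Rightarrow> nat \<Rightarrow> nat \<Rightarrow> nat" where
  "tau m n k = (THE t. \<forall>M. matching_in (K_edges m n) M \<and> card M = k \<longrightarrow>
     num_spanning_trees_containing m n M = t)"

end

theory Submission
  imports Defs
begin

text \<open>
  Let \<open>N F\<close> be the number of spanning trees of $K_{m,n}$ containing a forest \<open>F\<close> with \<open>c\<close> components,
  where a component \<open>X\<close> has \<open>a X\<close> left and \<open>b X\<close> right vertices. Every such tree has \<open>c - 1\<close> edges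
  outside \<open>F\<close>, so counting pairs of a tree and an edge of it outside \<open>F\<close> gives
  \<open>(c - 1) * N F = (\<Sum>e. N (insert e F))\<close>, where only the edges joining two different components
  contribute, and there are \<open>a X * b Y\<close> of them with left end in \<open>X\<close> and right end in \<open>Y\<close>.
  With \<open>d X = n * a X + m * b X\<close>, the expression
  \<open>(\<Prod>X. d X) * (1 - (\<Sum>X. a X * b X / d X)) / (m * n)\<close> satisfies the same recursion and equals 1 for
  a single component, so it equals \<open>N F\<close>. A matching of size \<open>k\<close> has \<open>k\<close> components with \<open>d X = m + n\<close>,
  and \<open>m - k\<close> and \<open>n - k\<close> singletons with \<open>d X = n\<close> and \<open>d X = m\<close> respectively.
\<close>

section \<open>Connected components and the effect of adding one edge\<close>

definition component :: "'a set set \<Rightarrow> 'a \<Rightarrow> 'a set" where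
  "component E v = {w. (v, w) \<in> {(x, y). {x, y} \<in> E}\<^sup>*}"

definition components :: "'a set \<Rightarrow> 'a set set \<Rightarrow> 'a set set" where
  "components V E = component E ` V"

definition acyclic_graph :: "'a set set \<Rightarrow> bool" where
  "acyclic_graph E \<longleftrightarrow> \<not> (\<exists>c. cycle_in E c)"

definition simple_edges :: "'a set \<Rightarrow> 'a set set" where
  "simple_edges V = {{x, y} | x y. x \<in> V \<and> y \<in> V \<and> x \<noteq> y}"

lemma tree_graph_iff: "tree_graph V E \<longleftrightarrow> connected_graph V E \<and> acyclic_graph E"
  by (simp add: tree_graph_def acyclic_graph_def)

lemma component_refl [simp]: "v \<in> component E v"
  by (simp add: component_def)

lemma component_sym: "w \<in> component E v \<Longrightarrow> v \<in> component E w"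
proof -
  have "sym {(x, y). {x, y} \<in> E}"
    by (auto simp: sym_def insert_commute)
  then show "w \<in> component E v \<Longrightarrow> v \<in> component E w"
    unfolding component_def by (auto dest: sym_rtrancl symD)
qed

lemma component_trans: "w \<in> component E v \<Longrightarrow> x \<in> component E w \<Longrightarrow> x \<in> component E v"
  unfolding component_def by (auto intro: rtrancl_trans)

lemma component_eq_iff: "component E v = component E w \<longleftrightarrow> w \<in> component E v"
proof
  assume "w \<in> component E v"
  then show "component E v = component E w"
    by (meson component_sym component_trans subsetI subset_antisym)
next
  assume "component E v = component E w"
  then show "w \<in> component E v" by simp
qed

lemma component_step: "w \<in> component E v \<Longrightarrow> {w, x} \<in> E \<Longrightarrow> x \<in> component E v"
  unfolding component_def by (auto intro: rtrancl_into_rtrancl)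

lemma component_induct [consumes 1, case_names base step]:
  assumes "w \<in> component E v" and "P v"
    and "\<And>x y. x \<in> component E v \<Longrightarrow> P x \<Longrightarrow> {x, y} \<in> E \<Longrightarrow> P y"
  shows "P w"
proof -
  have "(v, w) \<in> {(x, y). {x, y} \<in> E}\<^sup>*"
    using assms(1) by (simp add: component_def)
  then show ?thesis
    by (induction rule: rtrancl_induct) (use assms(2,3) in \<open>auto simp: component_def\<close>)
qed

lemma component_least:
  assumes "v \<in> S" and "\<And>x y. x \<in> S \<Longrightarrow> {x, y} \<in> E \<Longrightarrow> y \<in> S"
  shows "component E v \<subseteq> S"
proof
  fix w assume "w \<in> component E v"
  then show "w \<in> S" by (induction rule: component_induct) (use assms in auto)
qed

lemma component_mono:
  assumes "E \<subseteq> E'"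
  shows "component E v \<subseteq> component E' v"
  by (rule component_least) (use assms in \<open>auto intro: component_step\<close>)

lemma component_empty [simp]: "component {} v = {v}"
  using component_least[of v "{v}" "{}"] by auto

lemma component_subset:
  assumes "E \<subseteq> simple_edges V" and "v \<in> V"
  shows "component E v \<subseteq> V"
  by (rule component_least) (use assms in \<open>auto simp: simple_edges_def doubleton_eq_iff\<close>)

text \<open>The union of the components of \<open>u\<close> and \<open>v\<close> is closed under the
  edges of the enlarged graph, and a component that contains neither \<open>u\<close> nor
  \<open>v\<close> never meets the new edge.\<close>

lemma component_insert:
  "component (insert {u, v} E) w =
     (if w \<in> component E u \<union> component E v then component E u \<union> component E v
      else component E w)"
proof -
  let ?E = "insert {u, v} E"
  have mono: "component E x \<subseteq> component ?E x" for x
    by (rule component_mono) auto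
  have uv: "component ?E u = component ?E v"
    unfolding component_eq_iff by (rule component_step[of u]) auto
  show ?thesis
  proof (cases "w \<in> component E u \<union> component E v")
    case True
    have "w \<in> component ?E u \<or> w \<in> component ?E v"
      using True mono by blast
    then have "component ?E w = component ?E u"
      using uv by (simp flip: component_eq_iff)
    moreover have "component E u \<union> component E v \<subseteq> component ?E u"
      using mono[of u] mono[of v] uv by blast
    moreover have "component ?E w \<subseteq> component E u \<union> component E v"
      by (rule component_least) (use True in \<open>auto simp: doubleton_eq_iff intro: component_step\<close>)
    ultimately show ?thesis using True by auto
  next
    case False
    have "component ?E w \<subseteq> component E w"
    proof (rule component_least)
      fix x y assume x: "x \<in> component E w" and "{x, y} \<in> ?E"
      moreover have "x \<noteq> u" "x \<noteq> v" using False x component_sym by fastforce+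
      ultimately show "y \<in> component E w" by (auto simp: doubleton_eq_iff intro: component_step)
    qed simp
    then show ?thesis using False mono[of w] by auto
  qed
qed

lemma components_eqI: "X \<in> components V E \<Longrightarrow> v \<in> X \<Longrightarrow> component E v = X"
  by (auto simp: components_def simp flip: component_eq_iff)

lemma components_disjoint:
  "X \<in> components V E \<Longrightarrow> Y \<in> components V E \<Longrightarrow> X \<noteq> Y \<Longrightarrow> X \<inter> Y = {}"
  by (auto dest: components_eqI)

lemma finite_components: "finite V \<Longrightarrow> finite (components V E)"
  by (simp add: components_def)

lemma components_insert:
  assumes "u \<in> V" "v \<in> V"
  shows "components V (insert {u, v} E) =
    insert (component E u \<union> component E v) (components V E - {component E u, component E v})"
    (is "?L = ?R")
proof
  show "?L \<subseteq> ?R"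
  proof
    fix X assume "X \<in> ?L"
    then obtain w where w: "w \<in> V" "X = component (insert {u, v} E) w"
      by (auto simp: components_def)
    show "X \<in> ?R"
    proof (cases "w \<in> component E u \<union> component E v")
      case False
      then have "component E w \<noteq> component E u" "component E w \<noteq> component E v"
        using component_refl[of w E] by auto
      then show ?thesis using w False by (simp add: component_insert components_def)
    qed (simp add: w component_insert)
  qed
  have "component (insert {u, v} E) u = component E u \<union> component E v"
    by (simp add: component_insert)
  moreover have "component (insert {u, v} E) w = component E w"
    if "component E w \<noteq> component E u" "component E w \<noteq> component E v" for w
    using that by (simp add: component_insert flip: component_eq_iff)
  ultimately show "?R \<subseteq> ?L"
    using assms unfolding components_def by (auto simp: image_iff) metis+
qed

text \<open>Components sharing a vertex coincide, so a union that were itself a component would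
  equal both of its parts. Hence merging creates a genuinely new part: the number of components
  drops by exactly one, and sums and products over the new partition split off one fresh
  term.\<close>

lemma component_union_notin:
  assumes "component E u \<noteq> component E v"
  shows "component E u \<union> component E v \<notin> components V E"
proof
  assume *: "component E u \<union> component E v \<in> components V E"
  have "component E u = component E u \<union> component E v"
    by (rule components_eqI[OF *]) simp
  moreover have "component E v = component E u \<union> component E v"
    by (rule components_eqI[OF *]) simp
  ultimately show False using assms by simp
qed

lemma card_components_insert:
  assumes "finite V" "u \<in> V" "v \<in> V" "component E u \<noteq> component E v"
  shows "card (components V E) = Suc (card (components V (insert {u, v} E)))"
proof -
  let ?C = "components V E"
  have "{component E u, component E v} \<subseteq> ?C"
    using assms by (auto simp: components_def)
  then have "card ?C = card (?C - {component E u, component E v}) + 2"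
    using assms card_Diff_subset[of "{component E u, component E v}" ?C]
      card_mono[of ?C "{component E u, component E v}"] finite_components[of V E] by auto
  then show ?thesis
    using assms component_union_notin[OF assms(4), of V] finite_components[of V E]
    by (simp add: components_insert)
qed

section \<open>Cycles, forests and their number of components\<close>

lemma cycle_in_mono: "cycle_in E c \<Longrightarrow> E \<subseteq> E' \<Longrightarrow> cycle_in E' c"
  unfolding cycle_in_def by blast

lemma acyclic_graph_subset: "acyclic_graph E' \<Longrightarrow> E \<subseteq> E' \<Longrightarrow> acyclic_graph E"
  unfolding acyclic_graph_def using cycle_in_mono by blast

text \<open>A path to \<open>x\<close> is extended by the next vertex \<open>y\<close>, or cut off
  at \<open>y\<close> if it already runs through \<open>y\<close>, so the vertices stay
  distinct.\<close>

lemma component_path: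
  assumes "w \<in> component E v"
  shows "\<exists>p. p \<noteq> [] \<and> distinct p \<and> hd p = v \<and> last p = w \<and>
    (\<forall>i. Suc i < length p \<longrightarrow> {p ! i, p ! Suc i} \<in> E)"
  using assms
proof (induction rule: component_induct)
  case base
  show ?case by (rule exI[of _ "[v]"]) auto
next
  case (step x y)
  then obtain p where p: "p \<noteq> []" "distinct p" "hd p = v" "last p = x"
    "\<And>i. Suc i < length p \<Longrightarrow> {p ! i, p ! Suc i} \<in> E" by blast
  show ?case
  proof (cases "y \<in> set p")
    case True
    then obtain j where j: "j < length p" "p ! j = y" by (auto simp: in_set_conv_nth)
    have "last (take (Suc j) p) = y" "hd (take (Suc j) p) = v"
      using p j by (auto simp: take_Suc_conv_app_nth hd_append hd_conv_nth)
    then show ?thesis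
      using p j by (intro exI[of _ "take (Suc j) p"]) auto
  next
    case False
    have "{(p @ [y]) ! i, (p @ [y]) ! Suc i} \<in> E" if "Suc i < length (p @ [y])" for i
    proof (cases "Suc i < length p")
      case True
      then show ?thesis using p(5) by (simp add: nth_append)
    next
      case False
      then have "length p = Suc i" using that by simp
      then show ?thesis using p(1,4) step by (simp add: nth_append last_conv_nth)
    qed
    then show ?thesis
      using p False by (intro exI[of _ "p @ [y]"]) auto
  qed
qed

lemma cycle_in_insert:
  assumes "v \<in> component E u" "u \<noteq> v" "{u, v} \<notin> E"
  shows "\<exists>c. cycle_in (insert {u, v} E) c"
proof -
  obtain p where p: "p \<noteq> []" "distinct p" "hd p = u" "last p = v"
    "\<And>i. Suc i < length p \<Longrightarrow> {p ! i, p ! Suc i} \<in> E"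
    using component_path[OF assms(1)] by blast
  have uv: "p ! 0 = u" "p ! (length p - 1) = v"
    using p by (simp_all add: hd_conv_nth last_conv_nth)
  \<comment> \<open>One vertex would force \<open>u = v\<close>, and two would make
    \<open>{u, v}\<close> an edge of \<open>E\<close>. So closing the path with the new edge gives a
    cycle of the required length.\<close>
  have "length p \<noteq> 1" using uv assms(2) by auto
  moreover have "length p \<noteq> 2" using uv assms(3) p(5)[of 0] by auto
  moreover have "length p \<noteq> 0" using p by auto
  ultimately have len: "length p \<ge> 3" by linarith
  have "{p ! i, p ! (Suc i mod length p)} \<in> insert {u, v} E" if "i < length p" for i
  proof (cases "Suc i < length p")
    case True
    then show ?thesis using p(5) by simp
  next
    case False
    then have "length p = Suc i" using that by simp
    then show ?thesis using uv by (simp add: insert_commute)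
  qed
  then show ?thesis using len p(2) unfolding cycle_in_def by blast
qed

text \<open>A new cycle must use the edge \<open>{u, v}\<close>; the rest of the cycle is then a
  walk in \<open>E\<close> joining \<open>u\<close> and \<open>v\<close>, which contradicts their
  lying in different components.\<close>

lemma acyclic_graph_insert:
  assumes acyc: "acyclic_graph E" and comp: "component E u \<noteq> component E v"
  shows "acyclic_graph (insert {u, v} E)"
  unfolding acyclic_graph_def
proof
  assume "\<exists>c. cycle_in (insert {u, v} E) c"
  then obtain c where c: "cycle_in (insert {u, v} E) c" by blast
  define L where "L = length c"
  \<comment> \<open>The periodic extension of the cycle allows it to be read from any starting index
    without wrap-around cases.\<close>
  define s where "s i = c ! (i mod L)" for i
  have L: "L \<ge> 3" and dist: "distinct c"
    using c by (auto simp: cycle_in_def L_def)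
  have s_edge: "{s i, s (Suc i)} \<in> insert {u, v} E" for i
  proof -
    have "i mod L < L" using L by simp
    then have "{c ! (i mod L), c ! (Suc (i mod L) mod L)} \<in> insert {u, v} E"
      using c unfolding cycle_in_def L_def by blast
    then show ?thesis by (simp add: s_def mod_Suc_eq)
  qed
  have s_eq: "s i = s j \<longleftrightarrow> i mod L = j mod L" for i j
  proof -
    have "i mod L < L" "j mod L < L" using L by simp_all
    then show ?thesis using dist by (simp add: s_def L_def nth_eq_iff_index_eq)
  qed
  have "\<exists>i<L. {s i, s (Suc i)} = {u, v}"
  proof (rule ccontr)
    assume neg: "\<not> ?thesis"
    have "cycle_in E c"
      unfolding cycle_in_def
    proof (intro conjI allI impI)
      fix i assume "i < length c"
      then show "{c ! i, c ! (Suc i mod length c)} \<in> E"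
        using neg s_edge[of i] by (auto simp: s_def L_def)
    qed (use L dist L_def in auto)
    then show False using acyc by (auto simp: acyclic_graph_def)
  qed
  then obtain i where i: "i < L" "{s i, s (Suc i)} = {u, v}" by blast
  \<comment> \<open>Only the step at \<open>i\<close> can use the new edge. A second step with the
    same ends, in the same order, needs \<open>L dvd t\<close>; in reversed order, \<open>L\<close>
    divides both \<open>t + 1\<close> and \<open>t - 1\<close>, hence 2. Both are impossible for
    \<open>0 < t < L\<close> and \<open>L \<ge> 3\<close>.\<close>
  have edge: "{s (i + t), s (Suc (i + t))} \<in> E" if t: "0 < t" "t < L" for t
  proof -
    have "{s (i + t), s (Suc (i + t))} \<noteq> {s i, s (Suc i)}"
    proof
      assume "{s (i + t), s (Suc (i + t))} = {s i, s (Suc i)}"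
      then consider "s (i + t) = s i" | "s (i + t) = s (Suc i)" "s (Suc (i + t)) = s i"
        by (auto simp: doubleton_eq_iff)
      then show False
      proof cases
        case 1
        then have "(i + t) mod L = (i + 0) mod L" by (simp add: s_eq)
        then have "L dvd t" by (metis add_diff_cancel_left' add.right_neutral le_add1 mod_eq_dvd_iff_nat)
        then show False using t by (simp add: nat_dvd_not_less)
      next
        case 2
        then have *: "(i + t) mod L = (i + 1) mod L" "(i + (t + 1)) mod L = i mod L"
          by (simp_all add: s_eq)
        have "L dvd t + 1"
          using *(2) by (metis add_diff_cancel_left' le_add1 mod_eq_dvd_iff_nat)
        moreover have "L dvd t - 1"
          using *(1) t mod_eq_dvd_iff_nat[of "i + 1" "i + t" L] by simp
        ultimately have "L dvd (t + 1) - (t - 1)" by (rule dvd_diff_nat)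
        then have "L dvd 2" using t by simp
        then show False using L by (auto dest: dvd_imp_le)
      qed
    qed
    then show ?thesis using s_edge[of "i + t"] i by auto
  qed
  \<comment> \<open>Starting just after the new edge, \<open>L - 1\<close> further steps in
    \<open>E\<close> go round the cycle back to \<open>s i\<close>.\<close>
  have "s (i + Suc t) \<in> component E (s (Suc i))" if "Suc t \<le> L" for t
    using that
  proof (induction t)
    case (Suc t)
    then show ?case using edge[of "Suc t"] by (auto intro: component_step)
  qed simp
  from this[of "L - 1"] have "s i \<in> component E (s (Suc i))"
    using L by (simp add: s_def)
  then have "component E (s (Suc i)) = component E (s i)"
    by (simp add: component_eq_iff)
  then show False using comp i(2) by (auto simp: doubleton_eq_iff)
qed

lemma acyclic_graph_insert_iff:
  assumes "acyclic_graph E" "u \<noteq> v" "{u, v} \<notin> E"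
  shows "acyclic_graph (insert {u, v} E) \<longleftrightarrow> component E u \<noteq> component E v"
  using assms acyclic_graph_insert cycle_in_insert
  unfolding acyclic_graph_def component_eq_iff by metis

lemma finite_simple_edges: "finite V \<Longrightarrow> finite (simple_edges V)"
  by (rule finite_subset[of _ "Pow V"]) (auto simp: simple_edges_def)

text \<open>The edgeless graph has \<open>card V\<close> components, and each inserted edge of a
  forest joins two different components and lowers their number by one.\<close>

lemma card_forest:
  assumes "finite V" "F \<subseteq> simple_edges V" "acyclic_graph F"
  shows "card F + card (components V F) = card V"
proof -
  have "finite F" using assms finite_simple_edges finite_subset by blast
  then show ?thesis using assms(2,3)
  proof (induction F)
    case empty
    have "components V {} = (\<lambda>v. {v}) ` V" by (simp add: components_def)
    then show ?case by (simp add: card_image)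
  next
    case (insert e F)
    then obtain u v where e: "e = {u, v}" "u \<in> V" "v \<in> V" "u \<noteq> v"
      by (auto simp: simple_edges_def)
    have acyc: "acyclic_graph F" using insert.prems acyclic_graph_subset by blast
    then have "component F u \<noteq> component F v"
      using insert e acyclic_graph_insert_iff by metis
    from card_components_insert[OF assms(1) e(2,3) this] insert acyc e
    show ?case by simp
  qed
qed

lemma connected_graph_iff:
  assumes "E \<subseteq> simple_edges V"
  shows "connected_graph V E \<longleftrightarrow> components V E = {V}"
proof
  assume conn: "connected_graph V E"
  then have "component E v = V" if "v \<in> V" for v
    using component_subset[OF assms that] that
    by (auto simp: connected_graph_def component_def)
  then show "components V E = {V}"
    using conn by (auto simp: components_def connected_graph_def)
next
  assume *: "components V E = {V}"
  then have "component E v = V" if "v \<in> V" for v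
    using that by (auto simp: components_def)
  moreover have "V \<noteq> {}" using * by (auto simp: components_def)
  ultimately show "connected_graph V E"
    unfolding connected_graph_def component_def by blast
qed

lemma components_subset: "E \<subseteq> simple_edges V \<Longrightarrow> X \<in> components V E \<Longrightarrow> X \<subseteq> V"
  using component_subset[of E V] by (auto simp: components_def)

lemma Union_components: "E \<subseteq> simple_edges V \<Longrightarrow> \<Union> (components V E) = V"
  by (auto simp: components_def dest: component_subset intro: component_refl)

section \<open>The algebraic identity behind the recursion\<close>

text \<open>
  The factor of \<open>a X * b Y\<close> is the value of \<open>(\<Prod>X\<in>C. d X) * (1 - S)\<close> after merging \<open>X\<close> and \<open>Y\<close>
  into one part, divided by the product \<open>\<Prod>X\<in>C. d X\<close> before the merge.
\<close>

lemma merge_sum_identity: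
  fixes a b :: "'b \<Rightarrow> real" and A B :: real and C :: "'b set"
  defines "d \<equiv> \<lambda>X. B * a X + A * b X"
  defines "s \<equiv> \<lambda>X. a X * b X / d X"
  defines "S \<equiv> \<Sum>X\<in>C. s X"
  assumes fin: "finite C" and A: "sum a C = A" "A > 0" and B: "sum b C = B" "B > 0"
    and nz: "\<And>X. X \<in> C \<Longrightarrow> d X > 0"
  shows "(\<Sum>X\<in>C. \<Sum>Y\<in>C. a X * b Y * (if X = Y then 0 else
            (d X + d Y) / (d X * d Y) *
            (1 - (S - s X - s Y + (a X + a Y) * (b X + b Y) / (d X + d Y)))))
         = (real (card C) - 1) * (1 - S)"
proof -
  \<comment> \<open>Once expanded, every term of \<open>g X Y\<close> is a function of
    \<open>X\<close> times a function of \<open>Y\<close>, so that the double sum factors into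
    single sums.\<close>
  define g where "g X Y = (1 / d X + 1 / d Y) * (1 - S) - (a X * b Y + a Y * b X) / (d X * d Y)
     + s X / d X + s Y / d Y" for X Y
  have sd: "s X * d X = a X * b X" if "X \<in> C" for X
    using nz[OF that] by (simp add: s_def)
  have g: "(d X + d Y) / (d X * d Y) *
            (1 - (S - s X - s Y + (a X + a Y) * (b X + b Y) / (d X + d Y))) = g X Y"
    if "X \<in> C" "Y \<in> C" for X Y
  proof -
    have p: "d X > 0" "d Y > 0" "d X + d Y > 0" using nz that by (simp_all add: add_pos_pos)
    have "(d X + d Y) * (1 - (S - s X - s Y + (a X + a Y) * (b X + b Y) / (d X + d Y)))
      = (d X + d Y) * (1 - S) + (d X + d Y) * (s X + s Y) - (a X + a Y) * (b X + b Y)"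
      using p by (simp add: field_simps)
    \<comment> \<open>By \<open>sd\<close>, the products \<open>a X * b X\<close> and
      \<open>a Y * b Y\<close> occur on both sides of the subtraction and cancel; only mixed terms
      remain.\<close>
    also have "\<dots> = (d X + d Y) * (1 - S) - (a X * b Y + a Y * b X) + s X * d Y + s Y * d X"
      using sd[OF that(1)] sd[OF that(2)] by (simp add: algebra_simps)
    also have "\<dots> = g X Y * (d X * d Y)"
      using p unfolding g_def by (simp add: field_simps)
    finally have *: "(d X + d Y) *
        (1 - (S - s X - s Y + (a X + a Y) * (b X + b Y) / (d X + d Y))) = g X Y * (d X * d Y)" .
    show ?thesis
      using p by (simp only: times_divide_eq_left *) simp
  qed
  define Saa where "Saa = (\<Sum>X\<in>C. a X * a X / d X)"
  define Sbb where "Sbb = (\<Sum>X\<in>C. b X * b X / d X)"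
  \<comment> \<open>This is \<open>d X / d X = 1\<close>. Summing it over \<open>C\<close> with the
    weights \<open>a\<close>, \<open>b\<close>, 1 and \<open>s\<close> yields \<open>sum_a\<close>,
    \<open>sum_b\<close>, \<open>pq\<close> and \<open>pq'\<close>, the relations that evaluate all
    single sums.\<close>
  have one: "B * (a X / d X) + A * (b X / d X) = 1" if "X \<in> C" for X
  proof -
    have "B * (a X / d X) + A * (b X / d X) = (B * a X + A * b X) / d X"
      by (simp add: add_divide_distrib)
    also have "\<dots> = 1" using nz[OF that] by (simp add: d_def)
    finally show ?thesis .
  qed
  have sum_a: "B * Saa + A * S = A"
  proof -
    have "B * Saa + A * S = (\<Sum>X\<in>C. a X * (B * (a X / d X) + A * (b X / d X)))"
      by (simp add: Saa_def S_def s_def sum_distrib_left flip: sum.distrib)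
        (simp add: algebra_simps)
    also have "\<dots> = A" using A one by simp
    finally show ?thesis .
  qed
  have sum_b: "B * S + A * Sbb = B"
  proof -
    have "B * S + A * Sbb = (\<Sum>X\<in>C. b X * (B * (a X / d X) + A * (b X / d X)))"
      by (simp add: Sbb_def S_def s_def sum_distrib_left flip: sum.distrib)
        (simp add: algebra_simps)
    also have "\<dots> = B" using B one by simp
    finally show ?thesis .
  qed
  \<comment> \<open>Neither \<open>Saa\<close> nor \<open>Sbb\<close> has to be eliminated
    separately: only their product enters, and it is free of \<open>A\<close> and
    \<open>B\<close>.\<close>
  have "B * Saa = A * (1 - S)" "A * Sbb = B * (1 - S)"
    using sum_a sum_b by (simp_all add: algebra_simps)
  then have "(B * Saa) * (A * Sbb) = (A * (1 - S)) * (B * (1 - S))" by simp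
  then have "(A * B) * (Saa * Sbb) = (A * B) * ((1 - S) * (1 - S))" by (simp only: mult_ac)
  then have SS: "Saa * Sbb = (1 - S) * (1 - S)"
    using A(2) B(2) by (simp only: mult_cancel_left) simp
  have full: "(\<Sum>X\<in>C. \<Sum>Y\<in>C. a X * b Y * g X Y) =
      real (card C) * (1 - S) - (Saa * Sbb + S * S) + S"
  proof -
    define p where "p = (\<Sum>X\<in>C. a X / d X)"
    define q where "q = (\<Sum>X\<in>C. b X / d X)"
    define p' where "p' = (\<Sum>X\<in>C. a X / d X * s X)"
    define q' where "q' = (\<Sum>X\<in>C. b X / d X * s X)"
    have product: "(\<Sum>X\<in>C. \<Sum>Y\<in>C. f X * h Y) = sum f C * sum h C" for f h :: "'b \<Rightarrow> real"
      by (simp add: sum_product)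
    have "(\<Sum>X\<in>C. B * (a X / d X) + A * (b X / d X)) = real (card C)"
      using one by simp
    then have pq: "B * p + A * q = real (card C)"
      by (simp only: p_def q_def sum.distrib sum_distrib_left)
    have "(\<Sum>X\<in>C. B * (a X / d X * s X) + A * (b X / d X * s X)) =
        (\<Sum>X\<in>C. (B * (a X / d X) + A * (b X / d X)) * s X)"
      by (simp only: distrib_right mult.assoc)
    also have "\<dots> = S" using one by (simp add: S_def)
    finally have pq': "B * p' + A * q' = S"
      by (simp only: p'_def q'_def sum.distrib sum_distrib_left)
    have "(\<Sum>X\<in>C. \<Sum>Y\<in>C. a X * b Y * g X Y) =
        (\<Sum>X\<in>C. \<Sum>Y\<in>C. (a X / d X) * (b Y * (1 - S)) + (a X * (1 - S)) * (b Y / d Y)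
          - (a X * a X / d X) * (b Y * b Y / d Y) - s X * s Y
          + (a X / d X * s X) * b Y + a X * (b Y / d Y * s Y))"
      by (intro sum.cong refl)
        (simp add: g_def s_def algebra_simps add_divide_distrib diff_divide_distrib)
    also have "\<dots> = p * (\<Sum>X\<in>C. b X * (1 - S)) + (\<Sum>X\<in>C. a X * (1 - S)) * q
        - Saa * Sbb - S * S + p' * B + A * q'"
      unfolding p_def q_def p'_def q'_def Saa_def Sbb_def
      by (simp only: sum.distrib sum_subtractf product A(1) B(1) flip: S_def)
    also have "\<dots> = (B * p + A * q) * (1 - S) - (Saa * Sbb + S * S) + (B * p' + A * q')"
      by (simp only: A(1) B(1) flip: sum_distrib_right) (simp add: algebra_simps)
    finally show ?thesis by (simp only: pq pq')
  qed
  \<comment> \<open>The formula \<open>g\<close> also has values for \<open>X = Y\<close>, where no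
    merge takes place; they are included in \<open>full\<close> and removed here. On the diagonal
    the terms in the square of \<open>s X\<close> cancel.\<close>
  have diag: "(\<Sum>X\<in>C. a X * b X * g X X) = 2 * S * (1 - S)"
  proof -
    have "a X * b X * g X X = 2 * s X * (1 - S)" if "X \<in> C" for X
      using nz[OF that] by (simp add: g_def s_def field_simps)
    then show ?thesis by (simp add: S_def sum_distrib_left sum_distrib_right)
  qed
  have "(\<Sum>X\<in>C. \<Sum>Y\<in>C. a X * b Y * (if X = Y then 0 else
            (d X + d Y) / (d X * d Y) *
            (1 - (S - s X - s Y + (a X + a Y) * (b X + b Y) / (d X + d Y)))))
     = (\<Sum>X\<in>C. \<Sum>Y\<in>C. a X * b Y * g X Y - (if X = Y then a X * b X * g X X else 0))"
    by (intro sum.cong refl)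
      (simp only: g if_distrib mult_zero_right diff_self diff_zero split: if_split, simp)
  also have "\<dots> = (\<Sum>X\<in>C. \<Sum>Y\<in>C. a X * b Y * g X Y) - (\<Sum>X\<in>C. a X * b X * g X X)"
    using fin by (simp add: sum_subtractf)
  \<comment> \<open>The terms \<open>(1 - S) * (1 - S)\<close>, \<open>S * S\<close> and
    \<open>2 * S * (1 - S)\<close> add up to 1, which leaves
    \<open>card C * (1 - S) - 1 + S\<close>.\<close>
  also have "\<dots> = (real (card C) - 1) * (1 - S)"
    unfolding full diag SS by (simp add: algebra_simps)
  finally show ?thesis .
qed

section \<open>Component weights in the complete bipartite graph and the recursion of the closed
  form\<close>

definition left_count :: "('a + 'b) set \<Rightarrow> nat" where
  "left_count X = card (Inl -` X)"

definition right_count :: "('a + 'b) set \<Rightarrow> nat" where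
  "right_count X = card (Inr -` X)"

text \<open>For a set of vertices of \<open>K_{m,n}\<close> this is the sum of their degrees, since
  left vertices have degree \<open>n\<close> and right vertices degree \<open>m\<close>.\<close>

definition comp_weight :: "nat \<Rightarrow> nat \<Rightarrow> (nat + nat) set \<Rightarrow> real" where
  "comp_weight m n X = real n * real (left_count X) + real m * real (right_count X)"

text \<open>The numerator counts the edges of \<open>K_{m,n}\<close> with both ends in
  \<open>X\<close>.\<close>

definition comp_ratio :: "nat \<Rightarrow> nat \<Rightarrow> (nat + nat) set \<Rightarrow> real" where
  "comp_ratio m n X = real (left_count X) * real (right_count X) / comp_weight m n X"

text \<open>
  This closed form is what the matrix tree theorem gives for the multigraph obtained by contracting
  the parts \<open>X\<in>C\<close>, whose Laplacian is a diagonal matrix plus a matrix of rank two.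
\<close>

definition completions :: "nat \<Rightarrow> nat \<Rightarrow> (nat + nat) set set \<Rightarrow> real" where
  "completions m n C =
     (\<Prod>X\<in>C. comp_weight m n X) * (1 - (\<Sum>X\<in>C. comp_ratio m n X)) / (real m * real n)"

lemma K_edges_simple: "K_edges m n \<subseteq> simple_edges (K_verts m n)"
  by (force simp: K_edges_def simple_edges_def K_verts_def)

lemma finite_K_verts [simp]: "finite (K_verts m n)"
  by (simp add: K_verts_def)

lemma finite_K_edges [simp]: "finite (K_edges m n)"
  by (rule finite_subset[OF K_edges_simple finite_simple_edges]) simp

lemma K_edges_image: "K_edges m n = (\<lambda>(i, j). {Inl i, Inr j}) ` ({..<m} \<times> {..<n})"
  unfolding K_edges_def by auto

lemma inj_K_edge: "inj_on (\<lambda>(i, j). {Inl i, Inr j}) A"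
  by (auto simp: inj_on_def doubleton_eq_iff)

lemma Inl_in_K_verts [simp]: "Inl i \<in> K_verts m n \<longleftrightarrow> i < m"
  by (auto simp: K_verts_def)

lemma Inr_in_K_verts [simp]: "Inr j \<in> K_verts m n \<longleftrightarrow> j < n"
  by (auto simp: K_verts_def)

lemma finite_vimage_K:
  assumes "X \<subseteq> K_verts m n"
  shows "finite (Inl -` X)" "finite (Inr -` X)"
  using finite_subset[OF assms] by (simp_all add: finite_vimageI)

text \<open>Grouping the left vertices by component turns sums over edges of \<open>K_{m,n}\<close>
  into sums over pairs of components, the form needed for \<open>merge_sum_identity\<close>.\<close>

lemma sum_left_components:
  fixes f :: "(nat + nat) set \<Rightarrow> real"
  assumes "F \<subseteq> K_edges m n"
  defines "C \<equiv> components (K_verts m n) F"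
  shows "(\<Sum>i<m. f (component F (Inl i))) = (\<Sum>X\<in>C. real (left_count X) * f X)"
proof -
  have sub: "F \<subseteq> simple_edges (K_verts m n)" using assms K_edges_simple by blast
  have img: "(\<lambda>i. component F (Inl i)) ` {..<m} \<subseteq> C"
    by (auto simp: C_def components_def)
  have fiber: "{i \<in> {..<m}. component F (Inl i) = X} = Inl -` X" if "X \<in> C" for X
  proof -
    have X: "X \<in> components (K_verts m n) F" using that by (simp add: C_def)
    then have "i < m" if "Inl i \<in> X" for i
      using subsetD[OF components_subset[OF sub X] that] by simp
    moreover have "component F (Inl i) = X \<longleftrightarrow> Inl i \<in> X" for i
      using components_eqI[OF X, of "Inl i"] component_refl[of "Inl i" F] by blast
    ultimately show ?thesis by auto
  qed
  have "(\<Sum>i | i \<in> {..<m} \<and> component F (Inl i) = X. f (component F (Inl i))) =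
      real (left_count X) * f X" if "X \<in> C" for X
  proof -
    have "(\<Sum>i | i \<in> {..<m} \<and> component F (Inl i) = X. f (component F (Inl i))) =
        (\<Sum>i | i \<in> {..<m} \<and> component F (Inl i) = X. f X)"
      by (rule sum.cong) auto
    then show ?thesis by (simp only: fiber[OF that] sum_constant left_count_def)
  qed
  then show ?thesis
    using sum.group[of "{..<m}" C "\<lambda>i. component F (Inl i)" "\<lambda>i. f (component F (Inl i))"] img
    by (simp only: finite_lessThan C_def finite_components finite_K_verts cong: sum.cong)
qed

lemma sum_right_components:
  fixes f :: "(nat + nat) set \<Rightarrow> real"
  assumes "F \<subseteq> K_edges m n"
  defines "C \<equiv> components (K_verts m n) F"
  shows "(\<Sum>j<n. f (component F (Inr j))) = (\<Sum>X\<in>C. real (right_count X) * f X)"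
proof -
  have sub: "F \<subseteq> simple_edges (K_verts m n)" using assms K_edges_simple by blast
  have img: "(\<lambda>i. component F (Inr i)) ` {..<n} \<subseteq> C"
    by (auto simp: C_def components_def)
  have fiber: "{i \<in> {..<n}. component F (Inr i) = X} = Inr -` X" if "X \<in> C" for X
  proof -
    have X: "X \<in> components (K_verts m n) F" using that by (simp add: C_def)
    then have "i < n" if "Inr i \<in> X" for i
      using subsetD[OF components_subset[OF sub X] that] by simp
    moreover have "component F (Inr i) = X \<longleftrightarrow> Inr i \<in> X" for i
      using components_eqI[OF X, of "Inr i"] component_refl[of "Inr i" F] by blast
    ultimately show ?thesis by auto
  qed
  have "(\<Sum>i | i \<in> {..<n} \<and> component F (Inr i) = X. f (component F (Inr i))) =
      real (right_count X) * f X" if "X \<in> C" for X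
  proof -
    have "(\<Sum>i | i \<in> {..<n} \<and> component F (Inr i) = X. f (component F (Inr i))) =
        (\<Sum>i | i \<in> {..<n} \<and> component F (Inr i) = X. f X)"
      by (rule sum.cong) auto
    then show ?thesis by (simp only: fiber[OF that] sum_constant right_count_def)
  qed
  then show ?thesis
    using sum.group[of "{..<n}" C "\<lambda>i. component F (Inr i)" "\<lambda>i. f (component F (Inr i))"] img
    by (simp only: finite_lessThan C_def finite_components finite_K_verts cong: sum.cong)
qed

lemma comp_weight_pos:
  assumes "m \<ge> 1" "n \<ge> 1" "F \<subseteq> K_edges m n" "X \<in> components (K_verts m n) F"
  shows "comp_weight m n X > 0"
proof -
  have sub: "X \<subseteq> K_verts m n"
    using assms(4) by (rule components_subset[OF order_trans[OF assms(3) K_edges_simple]])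
  obtain v where "X = component F v" using assms(4) by (auto simp: components_def)
  then have "v \<in> X" by simp
  then have "Inl -` X \<noteq> {} \<or> Inr -` X \<noteq> {}" by (cases v) auto
  then have "left_count X > 0 \<or> right_count X > 0"
    using finite_vimage_K[OF sub] by (auto simp: left_count_def right_count_def card_gt_0_iff)
  then show ?thesis
    using assms(1,2) unfolding comp_weight_def
    by (auto intro: add_pos_nonneg add_nonneg_pos)
qed

lemma counts_Un:
  assumes "X \<subseteq> K_verts m n" "Y \<subseteq> K_verts m n" "X \<inter> Y = {}"
  shows "left_count (X \<union> Y) = left_count X + left_count Y"
    and "right_count (X \<union> Y) = right_count X + right_count Y"
  using assms finite_vimage_K[OF assms(1)] finite_vimage_K[OF assms(2)]
  by (auto simp: left_count_def right_count_def intro!: card_Un_disjoint)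

lemma completions_recursion:
  assumes mn: "m \<ge> 1" "n \<ge> 1" and F: "F \<subseteq> K_edges m n"
  defines "C \<equiv> components (K_verts m n) F"
  shows "(\<Sum>i<m. \<Sum>j<n. if component F (Inl i) = component F (Inr j) then 0
            else completions m n (components (K_verts m n) (insert {Inl i, Inr j} F)))
         = (real (card C) - 1) * completions m n C"
proof -
  let ?d = "comp_weight m n" and ?s = "comp_ratio m n"
  let ?a = "\<lambda>X. real (left_count X)" and ?b = "\<lambda>X. real (right_count X)"
  define P where "P = (\<Prod>X\<in>C. ?d X)"
  define S where "S = (\<Sum>X\<in>C. ?s X)"
  have fin: "finite C" by (simp add: C_def finite_components)
  have dpos: "?d X > 0" if "X \<in> C" for X
    using comp_weight_pos[OF mn F] that by (simp add: C_def)
  have sub: "X \<subseteq> K_verts m n" if "X \<in> C" for X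
    using that components_subset[OF order_trans[OF F K_edges_simple]] by (simp add: C_def)
  define H where "H X Y = (if X = Y then 0 else (?d X + ?d Y) / (?d X * ?d Y) *
      (1 - (S - ?s X - ?s Y + (?a X + ?a Y) * (?b X + ?b Y) / (?d X + ?d Y))))" for X Y
  \<comment> \<open>Merging replaces the factors \<open>?d X\<close> and \<open>?d Y\<close> of
    \<open>P\<close> by their sum, and the terms \<open>?s X\<close> and \<open>?s Y\<close> of
    \<open>S\<close> by the ratio of the union. \<open>H\<close> records this change, with value 0
    for pairs that are not merged.\<close>
  have merge: "completions m n (insert (X \<union> Y) (C - {X, Y})) = P / (real m * real n) * H X Y"
    if XY: "X \<in> C" "Y \<in> C" "X \<noteq> Y" "X \<union> Y \<notin> C" for X Y
  proof -
    have disj: "X \<inter> Y = {}" using XY components_disjoint unfolding C_def by blast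
    note cnt = counts_Un[OF sub[OF XY(1)] sub[OF XY(2)] disj]
    have d: "?d (X \<union> Y) = ?d X + ?d Y"
      by (simp add: comp_weight_def cnt algebra_simps)
    have C: "C = insert X (insert Y (C - {X, Y}))" using XY by blast
    have "P = ?d X * (?d Y * (\<Prod>Z\<in>C - {X, Y}. ?d Z))"
      unfolding P_def by (subst C) (use fin XY in simp)
    then have prod: "(\<Prod>Z\<in>C - {X, Y}. ?d Z) = P / (?d X * ?d Y)"
      using dpos[OF XY(1)] dpos[OF XY(2)] by simp
    have "S = ?s X + (?s Y + (\<Sum>Z\<in>C - {X, Y}. ?s Z))"
      unfolding S_def by (subst C) (use fin XY in simp)
    then have sum: "(\<Sum>Z\<in>C - {X, Y}. ?s Z) = S - ?s X - ?s Y" by simp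
    have s: "?s (X \<union> Y) = (?a X + ?a Y) * (?b X + ?b Y) / (?d X + ?d Y)"
      by (simp add: comp_ratio_def d cnt)
    show ?thesis
      unfolding completions_def H_def using fin XY by (simp add: prod sum d s add.commute mult_ac)
  qed
  have "(\<Sum>i<m. \<Sum>j<n. if component F (Inl i) = component F (Inr j) then 0
            else completions m n (components (K_verts m n) (insert {Inl i, Inr j} F)))
    = (\<Sum>i<m. \<Sum>j<n. P / (real m * real n) * H (component F (Inl i)) (component F (Inr j)))"
  proof (intro sum.cong refl)
    fix i j assume ij: "i \<in> {..<m}" "j \<in> {..<n}"
    then have "component F (Inl i) \<in> C" "component F (Inr j) \<in> C"
      by (auto simp: C_def components_def)
    then show "(if component F (Inl i) = component F (Inr j) then 0
        else completions m n (components (K_verts m n) (insert {Inl i, Inr j} F)))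
      = P / (real m * real n) * H (component F (Inl i)) (component F (Inr j))"
      using merge component_union_notin[of F "Inl i" "Inr j" "K_verts m n"] ij
      by (cases "component F (Inl i) = component F (Inr j)")
        (simp_all add: components_insert H_def flip: C_def)
  qed
  also have "\<dots> = P / (real m * real n) *
      (\<Sum>i<m. \<Sum>j<n. H (component F (Inl i)) (component F (Inr j)))"
    by (simp add: sum_distrib_left)
  also have "(\<Sum>i<m. \<Sum>j<n. H (component F (Inl i)) (component F (Inr j))) =
      (\<Sum>X\<in>C. \<Sum>Y\<in>C. ?a X * ?b Y * H X Y)"
    using sum_left_components[OF F, of "\<lambda>X. \<Sum>j<n. H X (component F (Inr j))"]
      sum_right_components[OF F]
    by (simp add: C_def sum_distrib_left mult.assoc)
  also have "\<dots> = (real (card C) - 1) * (1 - S)"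
  proof -
    have "sum ?a C = real m" "sum ?b C = real n"
      using sum_left_components[OF F, of "\<lambda>_. 1"] sum_right_components[OF F, of "\<lambda>_. 1"]
      by (simp_all add: C_def)
    from merge_sum_identity[OF fin this(1) _ this(2)] show ?thesis
      using mn dpos unfolding H_def S_def comp_ratio_def comp_weight_def by simp
  qed
  finally show ?thesis by (simp add: completions_def P_def S_def)
qed

section \<open>Counting the spanning trees that contain a forest\<close>

lemma sum_spanning_trees_insert:
  assumes F: "F \<subseteq> K_edges m n" "acyclic_graph F"
  shows "(\<Sum>e\<in>K_edges m n - F. num_spanning_trees_containing m n (insert e F)) =
    (card (components (K_verts m n) F) - 1) * num_spanning_trees_containing m n F"
proof -
  let ?V = "K_verts m n" and ?E = "K_edges m n"
  define TT where "TT = {T. spanning_tree_of ?V ?E T \<and> F \<subseteq> T}"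
  have "TT \<subseteq> Pow ?E" by (auto simp: TT_def spanning_tree_of_def)
  then have fin: "finite TT" by (rule finite_subset) simp
  \<comment> \<open>Applying \<open>card_forest\<close> to \<open>T\<close>, which has one
    component, and to \<open>F\<close> gives the number of edges of \<open>T\<close> outside
    \<open>F\<close>.\<close>
  have count: "card {e \<in> ?E - F. e \<in> T} = card (components ?V F) - 1" if "T \<in> TT" for T
  proof -
    have T: "T \<subseteq> ?E" "F \<subseteq> T" "connected_graph ?V T" "acyclic_graph T"
      using that by (auto simp: TT_def spanning_tree_of_def tree_graph_iff)
    have simple: "T \<subseteq> simple_edges ?V" "F \<subseteq> simple_edges ?V"
      using T F K_edges_simple by blast+
    have "card (components ?V T) = 1"
      using connected_graph_iff[OF simple(1)] T by simp
    then have "card T + 1 = card F + card (components ?V F)"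
      using card_forest[OF finite_K_verts simple(1) T(4)]
        card_forest[OF finite_K_verts simple(2) F(2)] by simp
    moreover have "{e \<in> ?E - F. e \<in> T} = T - F" using T by blast
    moreover have "card (T - F) = card T - card F"
      using T finite_subset[OF F(1)] by (intro card_Diff_subset) auto
    ultimately show ?thesis by simp
  qed
  have "(\<Sum>e\<in>?E - F. num_spanning_trees_containing m n (insert e F))
      = (\<Sum>e\<in>?E - F. card {T \<in> TT. e \<in> T})"
    unfolding num_spanning_trees_containing_def TT_def
    by (intro sum.cong refl arg_cong[where f = card]) auto
  \<comment> \<open>Pairs of a tree and an edge of it outside \<open>F\<close> are now counted by
    the tree instead of the edge.\<close>
  also have "\<dots> = (\<Sum>T\<in>TT. card (components ?V F) - 1)"
    by (rule sum_multicount_gen) (use fin count in auto)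
  finally show ?thesis
    by (simp add: TT_def num_spanning_trees_containing_def)
qed

lemma num_spanning_trees_cyclic:
  assumes "\<not> acyclic_graph F"
  shows "num_spanning_trees_containing m n F = 0"
proof -
  have "{T. spanning_tree_of (K_verts m n) (K_edges m n) T \<and> F \<subseteq> T} = {}"
    using assms acyclic_graph_subset[of _ F] by (auto simp: spanning_tree_of_def tree_graph_iff)
  then show ?thesis by (simp only: num_spanning_trees_containing_def card.empty)
qed

text \<open>Any further edge would have both ends in the single component of \<open>F\<close> and
  close a cycle, so \<open>F\<close> itself is the only tree containing it.\<close>

lemma num_spanning_trees_connected:
  assumes F: "F \<subseteq> K_edges m n" "acyclic_graph F" "components (K_verts m n) F = {K_verts m n}"
  shows "num_spanning_trees_containing m n F = 1"
proof -
  let ?V = "K_verts m n" and ?E = "K_edges m n"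
  have simple: "F \<subseteq> simple_edges ?V" using F K_edges_simple by blast
  have "T = F" if T: "T \<subseteq> ?E" "acyclic_graph T" "F \<subseteq> T" for T
  proof (rule ccontr)
    assume "T \<noteq> F"
    then obtain e where e: "e \<in> T" "e \<notin> F" using T by blast
    then obtain u v where uv: "e = {u, v}" "u \<in> ?V" "v \<in> ?V" "u \<noteq> v"
      using subsetD[OF order_trans[OF T(1) K_edges_simple] e(1)] by (auto simp: simple_edges_def)
    have "component F u = component F v"
      using imageI[OF uv(2), of "component F"] imageI[OF uv(3), of "component F"] F(3)
      by (simp add: components_def)
    then have "\<not> acyclic_graph (insert e F)"
      using acyclic_graph_insert_iff[OF F(2) uv(4)] uv(1) e(2) by simp
    moreover have "insert e F \<subseteq> T" using T(3) e(1) by simp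
    ultimately show False using acyclic_graph_subset[OF T(2)] by simp
  qed
  moreover have "connected_graph ?V F" using connected_graph_iff[OF simple] F by simp
  ultimately have "{T. spanning_tree_of ?V ?E T \<and> F \<subseteq> T} = {F}"
    using F by (auto simp: spanning_tree_of_def tree_graph_iff)
  then show ?thesis by (simp add: num_spanning_trees_containing_def)
qed

text \<open>The whole vertex set has weight \<open>2 * m * n\<close> and ratio 1/2.\<close>

lemma completions_connected:
  assumes "m \<ge> 1" "n \<ge> 1"
  shows "completions m n {K_verts m n} = 1"
proof -
  have "Inl -` K_verts m n = {..<m}" "Inr -` K_verts m n = {..<n}" by auto
  then have "left_count (K_verts m n) = m" "right_count (K_verts m n) = n"
    by (simp_all add: left_count_def right_count_def)
  then show ?thesis
    using assms by (simp add: completions_def comp_ratio_def comp_weight_def field_simps)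
qed

text \<open>Induction on the number of components: both sides agree for one component and obey the
  same recursion, whose right-hand terms belong to forests with one component fewer.\<close>

theorem num_spanning_trees_containing_forest:
  assumes mn: "m \<ge> 1" "n \<ge> 1" and F: "F \<subseteq> K_edges m n" "acyclic_graph F"
  shows "real (num_spanning_trees_containing m n F) =
    completions m n (components (K_verts m n) F)"
  using F
proof (induction "card (components (K_verts m n) F)" arbitrary: F rule: less_induct)
  case less
  let ?V = "K_verts m n" and ?E = "K_edges m n"
  let ?c = "card (components ?V F)"
  let ?N = "num_spanning_trees_containing m n"
  have simple: "F \<subseteq> simple_edges ?V" using less.prems K_edges_simple by blast
  have "Inl 0 \<in> ?V" using mn by simp
  then have "?V \<noteq> {}" by blast
  then have "?c > 0" using finite_components[OF finite_K_verts, of m n F]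
    by (auto simp: card_gt_0_iff components_def)
  show ?case
  proof (cases "?c = 1")
    case True
    then have "components ?V F = {?V}"
      using Union_components[OF simple] by (auto simp: card_1_singleton_iff)
    then show ?thesis
      using num_spanning_trees_connected[OF less.prems] completions_connected[OF mn] by simp
  next
    case False
    \<comment> \<open>If the ends share a component, the edge is in \<open>F\<close> or closes a
      cycle, so both sides vanish. Otherwise the enlarged forest has fewer components and the
      induction hypothesis applies.\<close>
    have step: "(if {Inl i, Inr j} \<in> F then 0 else real (?N (insert {Inl i, Inr j} F))) =
        (if component F (Inl i) = component F (Inr j) then 0
         else completions m n (components ?V (insert {Inl i, Inr j} F)))"
      if ij: "i < m" "j < n" for i j
    proof (cases "component F (Inl i) = component F (Inr j)")
      case True
      then show ?thesis
        using acyclic_graph_insert_iff[OF less.prems(2), of "Inl i" "Inr j"]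
        by (auto intro: num_spanning_trees_cyclic)
    next
      case False
      then have "{Inl i, Inr j} \<notin> F"
        by (auto simp: component_eq_iff intro: component_step[of "Inl i"])
      moreover have "card (components ?V (insert {Inl i, Inr j} F)) < ?c"
        using card_components_insert[OF _ _ _ False, of ?V] ij by simp
      moreover have "insert {Inl i, Inr j} F \<subseteq> ?E"
        using ij less.prems by (auto simp: K_edges_def)
      ultimately show ?thesis
        using less.hyps acyclic_graph_insert[OF less.prems(2) False] False by simp
    qed
    have "(real ?c - 1) * real (?N F) = (\<Sum>e\<in>?E - F. real (?N (insert e F)))"
      using sum_spanning_trees_insert[OF less.prems] \<open>?c > 0\<close>
      by (simp flip: of_nat_sum)
    also have "\<dots> = (\<Sum>e\<in>?E. if e \<in> F then 0 else real (?N (insert e F)))"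
      by (simp add: sum.If_cases Diff_eq)
    also have "\<dots> = (\<Sum>i<m. \<Sum>j<n. if {Inl i, Inr j} \<in> F then 0
        else real (?N (insert {Inl i, Inr j} F)))"
      unfolding K_edges_image sum.reindex[OF inj_K_edge] sum.cartesian_product
      by (simp add: case_prod_unfold)
    also have "\<dots> = (real ?c - 1) * completions m n (components ?V F)"
      unfolding completions_recursion[OF mn less.prems(1), symmetric]
      by (intro sum.cong refl step) auto
    \<comment> \<open>The factor \<open>?c - 1\<close> can be cancelled because \<open>?c\<close> is
      neither 0 nor 1.\<close>
    finally show ?thesis using False \<open>?c > 0\<close> by simp
  qed
qed

section \<open>Specialization to matchings\<close>

text \<open>Two consecutive edges of a cycle are distinct but share a vertex, which a matching
  forbids.\<close>

lemma acyclic_matching: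
  assumes "matching_in E M"
  shows "acyclic_graph M"
  unfolding acyclic_graph_def
proof
  assume "\<exists>c. cycle_in M c"
  then obtain c where len: "length c \<ge> 3" and dist: "distinct c"
    and edges: "\<And>i. i < length c \<Longrightarrow> {c ! i, c ! (Suc i mod length c)} \<in> M"
    by (auto simp: cycle_in_def)
  have "0 < length c" "1 < length c" "2 < length c" using len by auto
  then have "{c ! 0, c ! 1} \<in> M" "{c ! 1, c ! 2} \<in> M"
    using edges[of 0] edges[of 1] by (simp_all add: numeral_2_eq_2)
  moreover have "c ! 0 \<noteq> c ! 1" "c ! 0 \<noteq> c ! 2"
    using nth_eq_iff_index_eq[OF dist] \<open>0 < length c\<close> \<open>1 < length c\<close> \<open>2 < length c\<close>
    by (metis zero_neq_one zero_neq_numeral)+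
  then have "{c ! 0, c ! 1} \<noteq> {c ! 1, c ! 2}" by auto
  moreover have "pairwise disjnt M" using assms by (simp add: matching_in_def)
  ultimately have "disjnt {c ! 0, c ! 1} {c ! 1, c ! 2}" by (blast dest: pairwiseD)
  then show False by (simp add: disjnt_def)
qed

lemma component_isolated:
  assumes "v \<notin> \<Union> M"
  shows "component M v = {v}"
  using component_least[of v "{v}" M] assms by auto

lemma component_matching:
  assumes M: "pairwise disjnt M" "M \<subseteq> simple_edges V" and e: "e \<in> M" "v \<in> e"
  shows "component M v = e"
proof
  show "component M v \<subseteq> e"
  proof (rule component_least)
    fix x y assume "x \<in> e" "{x, y} \<in> M"
    then have "{x, y} = e" using pairwiseD[OF M(1), of "{x, y}" e] e(1) by (auto simp: disjnt_def)
    then show "y \<in> e" by auto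
  qed (rule e)
  obtain w where "e = {v, w}"
    using e M(2) by (auto simp: simple_edges_def)
  then show "e \<subseteq> component M v"
    using component_step[of v M v w] e(1) by auto
qed

lemma components_matching:
  assumes "pairwise disjnt M" "M \<subseteq> simple_edges V"
  shows "components V M = M \<union> (\<lambda>v. {v}) ` (V - \<Union> M)"
proof
  show "components V M \<subseteq> M \<union> (\<lambda>v. {v}) ` (V - \<Union> M)"
  proof
    fix X assume "X \<in> components V M"
    then obtain v where v: "v \<in> V" "X = component M v" by (auto simp: components_def)
    show "X \<in> M \<union> (\<lambda>v. {v}) ` (V - \<Union> M)"
      using v component_matching[OF assms] component_isolated[of v M]
      by (cases "v \<in> \<Union> M") auto
  qed
  have "e \<in> components V M" if e: "e \<in> M" for e
  proof -
    obtain v where "v \<in> e" "v \<in> V" using assms(2) e by (auto simp: simple_edges_def)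
    then show ?thesis using component_matching[OF assms e] by (auto simp: components_def)
  qed
  moreover have "{v} \<in> components V M" if "v \<in> V - \<Union> M" for v
    using that component_isolated[of v M] by (auto simp: components_def)
  ultimately show "M \<union> (\<lambda>v. {v}) ` (V - \<Union> M) \<subseteq> components V M" by auto
qed

lemma num_spanning_trees_matching:
  assumes mn: "m \<ge> 1" "n \<ge> 1" and M: "matching_in (K_edges m n) M"
  defines "k \<equiv> card M"
  shows "real (num_spanning_trees_containing m n M) =
    (real m + real n) ^ k * real n ^ (m - k) * real m ^ (n - k) *
    (1 - real k / (real m + real n)) / (real m * real n)"
proof -
  let ?V = "K_verts m n"
  have ME: "M \<subseteq> K_edges m n" and pw: "pairwise disjnt M"
    using M by (auto simp: matching_in_def)
  have simple: "M \<subseteq> simple_edges ?V" using ME K_edges_simple by blast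
  have finM: "finite M" using ME finite_K_edges by (rule finite_subset)
  define I where "I = {i. i < m \<and> Inl i \<notin> \<Union> M}"
  define J where "J = {j. j < n \<and> Inr j \<notin> \<Union> M}"
  let ?L = "(\<lambda>i. {Inl i :: nat + nat}) ` I" and ?R = "(\<lambda>j. {Inr j :: nat + nat}) ` J"
  define C where "C = components ?V M"
  have "?V - \<Union> M = Inl ` I \<union> Inr ` J"
    by (auto simp: K_verts_def I_def J_def)
  then have C: "C = M \<union> (?L \<union> ?R)"
    unfolding C_def components_matching[OF pw simple] by (simp add: image_Un image_image)
  have fin: "finite I" "finite J" by (auto simp: I_def J_def)
  have disj: "M \<inter> (?L \<union> ?R) = {}" "?L \<inter> ?R = {}"
    by (auto simp: I_def J_def)
  have inj: "inj_on (\<lambda>i. {Inl i :: nat + nat}) I" "inj_on (\<lambda>j. {Inr j :: nat + nat}) J"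
    by (auto simp: inj_on_def)
  have edge: "left_count e = 1 \<and> right_count e = 1" if e: "e \<in> M" for e
  proof -
    obtain i j where "e = {Inl i, Inr j}" using subsetD[OF ME e] by (auto simp: K_edges_def)
    then have "Inl -` e = {i}" "Inr -` e = {j}" by auto
    then show ?thesis by (simp add: left_count_def right_count_def)
  qed
  have "Inl -` {Inl i :: nat + nat} = {i}" "Inr -` {Inl i :: nat + nat} = {}"
    "Inl -` {Inr i :: nat + nat} = {}" "Inr -` {Inr i :: nat + nat} = {i}" for i by auto
  then have single: "left_count {Inl i :: nat + nat} = 1" "right_count {Inl i :: nat + nat} = 0"
    "left_count {Inr i :: nat + nat} = 0" "right_count {Inr i :: nat + nat} = 1" for i
    by (simp_all add: left_count_def right_count_def)
  \<comment> \<open>Every sum needed is constant on matching edges, on left singletons and on right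
    singletons. The instances are the sum of \<open>comp_ratio\<close>, where singletons contribute
    0, and the left and right vertex counts, which determine \<open>card I\<close> and
    \<open>card J\<close>.\<close>
  have sum_C: "(\<Sum>X\<in>C. f X) = real k * p + real (card I) * q + real (card J) * r"
    if "\<And>X. X \<in> M \<Longrightarrow> f X = p" "\<And>i. f {Inl i} = q" "\<And>j. f {Inr j} = r"
    for f :: "(nat + nat) set \<Rightarrow> real" and p q r
    unfolding C using that finM fin disj inj
    by (simp add: sum.union_disjoint sum.reindex k_def)
  have "(\<Prod>X\<in>C. comp_weight m n X) =
      (real m + real n) ^ k * (real n ^ card I * real m ^ card J)"
    unfolding C using finM fin disj inj
    by (simp add: prod.union_disjoint prod.reindex k_def comp_weight_def edge single add.commute)
  moreover have "(\<Sum>X\<in>C. comp_ratio m n X) = real k / (real m + real n)"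
    by (subst sum_C[of _ "1 / (real m + real n)" 0 0])
      (simp_all add: comp_ratio_def comp_weight_def edge single add.commute)
  moreover have "real m = (\<Sum>X\<in>C. real (left_count X))"
    using sum_left_components[OF ME, of "\<lambda>_. 1"] by (simp add: C_def)
  then have "real m = real k + real (card I)"
    by (subst (asm) sum_C[of _ 1 1 0]) (simp_all add: edge single)
  then have "card I = m - k" by linarith
  moreover have "real n = (\<Sum>X\<in>C. real (right_count X))"
    using sum_right_components[OF ME, of "\<lambda>_. 1"] by (simp add: C_def)
  then have "real n = real k + real (card J)"
    by (subst (asm) sum_C[of _ 1 0 1]) (simp_all add: edge single)
  then have "card J = n - k" by linarith
  ultimately show ?thesis
    using num_spanning_trees_containing_forest[OF mn ME acyclic_matching[OF M]]
    by (simp add: completions_def mult.assoc flip: C_def)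
qed

section \<open>The value of \<open>tau\<close> and the quotient of consecutive values\<close>

text \<open>The first \<open>k\<close> diagonal edges form such a matching. Its existence keeps the
  description defining \<open>tau\<close> from being vacuous, so that \<open>tau_formula\<close> can
  evaluate it.\<close>

lemma ex_matching:
  assumes "k \<le> min m n"
  shows "\<exists>M. matching_in (K_edges m n) M \<and> card M = k"
proof (intro exI conjI)
  let ?M = "(\<lambda>i. {Inl i, Inr i}) ` {..<k}"
  show "matching_in (K_edges m n) ?M"
    using assms by (auto simp: matching_in_def K_edges_image pairwise_def disjnt_def)
  show "card ?M = k"
    by (subst card_image) (auto simp: inj_on_def doubleton_eq_iff)
qed

text \<open>The closed formula for matchings involves \<open>M\<close> only through
  \<open>card M\<close>, so the count is common to all matchings of that size, and \<open>M\<close>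
  itself makes the common value unique.\<close>

lemma num_spanning_trees_eq_tau:
  assumes mn: "m \<ge> 1" "n \<ge> 1" and M: "matching_in (K_edges m n) M"
  shows "num_spanning_trees_containing m n M = tau m n (card M)"
proof -
  let ?N = "num_spanning_trees_containing m n"
  have eq: "?N M' = ?N M" if "matching_in (K_edges m n) M' \<and> card M' = card M" for M'
    using num_spanning_trees_matching[OF mn M] num_spanning_trees_matching[OF mn, of M'] that
    by simp
  have "tau m n (card M) = ?N M"
    unfolding tau_def by (rule the_equality) (use eq M in blast)+
  then show ?thesis by simp
qed

lemma tau_formula:
  assumes "m \<ge> 1" "n \<ge> 1" "k \<le> min m n"
  shows "real (tau m n k) =
    (real m + real n) ^ k * real n ^ (m - k) * real m ^ (n - k) *
    (1 - real k / (real m + real n)) / (real m * real n)"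
proof -
  obtain M where M: "matching_in (K_edges m n) M" "card M = k"
    using ex_matching[OF assms(3)] by blast
  show ?thesis
    using num_spanning_trees_matching[OF assms(1,2) M(1)]
      num_spanning_trees_eq_tau[OF assms(1,2) M(1)] M(2) by simp
qed

theorem theorem3p2:
  fixes m n :: nat
  assumes "m \<ge> 1" and "n \<ge> 1"
  shows "(\<forall>k M. k \<le> min m n \<and> matching_in (K_edges m n) M \<and> card M = k \<longrightarrow>
            num_spanning_trees_containing m n M = tau m n k) \<and>
         (\<forall>k. 1 \<le> k \<and> k \<le> min m n - 1 \<longrightarrow>
            real (tau m n (k + 1)) / real (tau m n k) =
              (real m + real n) * (real m + real n - real k - 1) /
              (real m * real n * (real m + real n - real k)))"
proof (intro conjI allI impI)
  fix k M
  assume "k \<le> min m n \<and> matching_in (K_edges m n) M \<and> card M = k"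
  then show "num_spanning_trees_containing m n M = tau m n k"
    using num_spanning_trees_eq_tau[OF assms] by blast
next
  fix k assume "1 \<le> k \<and> k \<le> min m n - 1"
  \<comment> \<open>Since \<open>min m n\<close> is positive, the truncated subtraction is exact and
    a matching of size \<open>k + 1\<close> exists.\<close>
  then have k: "k \<le> min m n" "k + 1 \<le> min m n" using assms by auto
  define s where "s = real m + real n"
  \<comment> \<open>\<open>P\<close> is the common factor of both values of \<open>tau\<close>. Its
    exponents are those for \<open>k + 1\<close>; the value at \<open>k\<close> has one more factor
    \<open>n\<close> and one more factor \<open>m\<close>, the value at \<open>k + 1\<close> one
    more factor \<open>s\<close>.\<close>
  define P where
    "P = s ^ k * real n ^ (m - (k + 1)) * real m ^ (n - (k + 1)) / (real m * real n * s)"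
  have pos: "real m > 0" "real n > 0" "s > 0" "s - real k > 0"
    using assms k by (auto simp: s_def)
  have "m - k = Suc (m - (k + 1))" "n - k = Suc (n - (k + 1))" using k by auto
  then have "real (tau m n k) = P * (real m * real n * (s - real k))"
    using tau_formula[OF assms k(1)] pos unfolding P_def by (simp add: field_simps flip: s_def)
  moreover have "real (tau m n (k + 1)) = P * (s * (s - real k - 1))"
    using tau_formula[OF assms k(2)] pos unfolding P_def by (simp add: field_simps flip: s_def)
  moreover have "P \<noteq> 0" using pos by (simp add: P_def)
  ultimately show "real (tau m n (k + 1)) / real (tau m n k) =
      (real m + real n) * (real m + real n - real k - 1) /
      (real m * real n * (real m + real n - real k))"
    by (simp flip: s_def)
qed

end
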